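(* Let $\Gamma$ be a discrete countable group and let $\sigma:\Gamma^2\to\mathbb{R}$ be a normalized 2-cocycle with $[\sigma]\neq 0$ in $H^2(\Gamma,\mathbb{R})$. For $n\ge 1$ put $\omega_n=e^{2\pi i\sigma/n}$ and let $\rho_n:\Gamma\to U(L(\Gamma,\omega_n))$ be the canonical map into the unitary group of the twisted group von Neumann algebra $L(\Gamma,\omega_n)$. Then there exists no sequence of group homomorphisms $\pi_n:\Gamma\to GL(L(\Gamma,\omega_n))$ such that $\lim_{n\to\infty}\|\rho_n(s)-\pi_n(s)\|=0$ for all $s\in\Gamma$.
   Context: Cohomology is taken with trivial $\Gamma$-action. A 2-cocycle $\sigma:\Gamma^2\to\mathbb{R}$ satisfies $\sigma(a,b)+\sigma(ab,c)=\sigma(a,bc)+\sigma(b,c)$ for all $a,b,c\in\Gamma$; it is normalized if $\sigma(a,e)=\sigma(e,a)=0$ for all $a$. It is a coboundary if $\sigma(a,b)=\gamma(a)-\gamma(ab)+\gamma(b)$ for some function $\gamma:\Gamma\to\mathbb{R}$; $H^2(\Gamma,\mathbb{R})$ is the group of 2-cocycles modulo coboundaries. For a normalized 2-cocycle $\omega:\Gamma^2\to\mathbb{T}$ (written multiplicatively), define unitaries $\bar\rho_\omega(s)$ on $\ell^2(\Gamma)$ by $\bar\rho_\omega(s)\delta_t=\omega(s,t)\delta_{st}$; they satisfy $\bar\rho_\omega(s)\bar\rho_\omega(t)=\omega(s,t)\bar\rho_\omega(st)$. The twisted group von Neumann algebra $L(\Gamma,\omega)$ is the weak operator closure of the linear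 span of $\{\bar\rho_\omega(s):s\in\Gamma\}$. The canonical map $\rho_n$ is $s\mapsto\bar\rho_{\omega_n}(s)$ with $\omega_n(s,t)=e^{2\pi i\sigma(s,t)/n}$. $GL(B)$ denotes the group of invertible elements of a unital algebra $B$, and $\|\cdot\|$ is the operator norm. *)

theory Defs
  imports "HOL-Analysis.Analysis"
begin

text \<open>
  The group is the additively written, in general non-commutative, type class \<^class>\<open>group_add\<close>:
  \<open>s + t\<close> is the product \<open>st\<close>, \<open>0\<close> the neutral element \<open>e\<close> and \<open>- s\<close> the inverse of \<open>s\<close>.
\<close>

section \<open>Second cohomology with real coefficients and trivial action\<close>

definition two_cocycles :: "('g::group_add \<Rightarrow> 'g \<Rightarrow> real) set" where
  "two_cocycles = {\<sigma>. \<forall>a b c. \<sigma> a b + \<sigma> (a + b) c = \<sigma> a (b + c) + \<sigma> b c}"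

definition normalized :: "('g::group_add \<Rightarrow> 'g \<Rightarrow> real) \<Rightarrow> bool" where
  "normalized \<sigma> \<longleftrightarrow> (\<forall>a. \<sigma> a 0 = 0 \<and> \<sigma> 0 a = 0)"

definition two_coboundaries :: "('g::group_add \<Rightarrow> 'g \<Rightarrow> real) set" where
  "two_coboundaries = {\<sigma>. \<exists>\<gamma>. \<forall>a b. \<sigma> a b = \<gamma> a - \<gamma> (a + b) + \<gamma> b}"

definition cohomologous :: "(('g::group_add \<Rightarrow> 'g \<Rightarrow> real) \<times> ('g \<Rightarrow> 'g \<Rightarrow> real)) set" where
  "cohomologous = {(\<sigma>, \<tau>). \<sigma> \<in> two_cocycles \<and> \<tau> \<in> two_cocycles \<and>
     (\<lambda>a b. \<sigma> a b - \<tau> a b) \<in> two_coboundaries}"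

definition H2 :: "('g::group_add \<Rightarrow> 'g \<Rightarrow> real) set set" where
  "H2 = two_cocycles // cohomologous"

definition H2_class :: "('g::group_add \<Rightarrow> 'g \<Rightarrow> real) \<Rightarrow> ('g \<Rightarrow> 'g \<Rightarrow> real) set" where
  "H2_class \<sigma> = cohomologous `` {\<sigma>}"

definition H2_zero :: "('g::group_add \<Rightarrow> 'g \<Rightarrow> real) set" where
  "H2_zero = H2_class (\<lambda>_ _. 0)"

lemma two_coboundaries_diff:
  assumes "\<sigma> \<in> two_coboundaries" "\<tau> \<in> two_coboundaries"
  shows "(\<lambda>a b. \<sigma> a b - \<tau> a b) \<in> two_coboundaries"
proof -
  obtain f g where "\<forall>a b. \<sigma> a b = f a - f (a + b) + f b" "\<forall>a b. \<tau> a b = g a - g (a + b) + g b"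
    using assms unfolding two_coboundaries_def by blast
  then show ?thesis
    unfolding two_coboundaries_def by (intro CollectI exI[of _ "\<lambda>a. f a - g a"]) simp
qed

lemma zero_two_coboundary: "(\<lambda>_ _. 0) \<in> two_coboundaries"
  unfolding two_coboundaries_def by (intro CollectI exI[of _ "\<lambda>_. 0"]) simp

lemma equiv_cohomologous: "equiv (two_cocycles :: ('g::group_add \<Rightarrow> 'g \<Rightarrow> real) set) cohomologous"
  (is "equiv ?Z ?R")
proof (rule equivI)
  show "?R \<subseteq> ?Z \<times> ?Z"
    by (auto simp: cohomologous_def)
  show "refl_on ?Z ?R"
    using zero_two_coboundary by (auto simp: refl_on_def cohomologous_def)
  show "sym ?R"
  proof (rule symI)
    fix \<sigma> \<tau> :: "'g \<Rightarrow> 'g \<Rightarrow> real"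
    assume "(\<sigma>, \<tau>) \<in> ?R"
    then show "(\<tau>, \<sigma>) \<in> ?R"
      using two_coboundaries_diff[OF zero_two_coboundary, of "\<lambda>a b. \<sigma> a b - \<tau> a b"]
      by (auto simp: cohomologous_def)
  qed
  show "trans ?R"
  proof (rule transI)
    fix \<sigma> \<tau> \<upsilon> :: "'g \<Rightarrow> 'g \<Rightarrow> real"
    assume *: "(\<sigma>, \<tau>) \<in> ?R" "(\<tau>, \<upsilon>) \<in> ?R"
    have "(\<lambda>a b. \<upsilon> a b - \<tau> a b) \<in> two_coboundaries"
      using two_coboundaries_diff[OF zero_two_coboundary, of "\<lambda>a b. \<tau> a b - \<upsilon> a b"] *
      by (auto simp: cohomologous_def)
    with two_coboundaries_diff[of "\<lambda>a b. \<sigma> a b - \<tau> a b" "\<lambda>a b. \<upsilon> a b - \<tau> a b"] *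
    show "(\<sigma>, \<upsilon>) \<in> ?R"
      by (auto simp: cohomologous_def)
  qed
qed

lemma H2_class_eq_zero_iff:
  fixes \<sigma> :: "'g::group_add \<Rightarrow> 'g \<Rightarrow> real"
  assumes "\<sigma> \<in> two_cocycles"
  shows "H2_class \<sigma> = H2_zero \<longleftrightarrow> \<sigma> \<in> two_coboundaries"
proof -
  have "(\<lambda>_ _. 0) \<in> (two_cocycles :: ('g \<Rightarrow> 'g \<Rightarrow> real) set)"
    by (simp add: two_cocycles_def)
  then show ?thesis
    using assms eq_equiv_class_iff[OF equiv_cohomologous, of \<sigma> "\<lambda>_ _. 0"]
    by (simp add: H2_class_def H2_zero_def cohomologous_def)
qed


section \<open>The Hilbert space of square-summable functions\<close>

typedef 'a ell2 = "{f :: 'a \<Rightarrow> complex. (\<lambda>x. (cmod (f x))\<^sup>2) summable_on UNIV}"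
  morphisms ell2_apply Abs_ell2
  by (rule exI[of _ "\<lambda>_. 0"]) simp

setup_lifting type_definition_ell2

lemma ell2_eqI: "(\<And>x. ell2_apply f x = ell2_apply g x) \<Longrightarrow> f = g"
  by (metis ell2_apply_inject ext)

lemma ell2_summable: "(\<lambda>x. (cmod (ell2_apply f x))\<^sup>2) summable_on UNIV"
  using ell2_apply by blast

lemma square_summable_add:
  fixes f g :: "'a \<Rightarrow> complex"
  assumes "(\<lambda>x. (cmod (f x))\<^sup>2) summable_on UNIV" "(\<lambda>x. (cmod (g x))\<^sup>2) summable_on UNIV"
  shows "(\<lambda>x. (cmod (f x + g x))\<^sup>2) summable_on UNIV"
proof (rule summable_on_comparison_test)
  show "(\<lambda>x. 2 * (cmod (f x))\<^sup>2 + 2 * (cmod (g x))\<^sup>2) summable_on UNIV"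
    by (intro summable_on_add summable_on_cmult_right assms)
  show "(cmod (f x + g x))\<^sup>2 \<le> 2 * (cmod (f x))\<^sup>2 + 2 * (cmod (g x))\<^sup>2" for x
  proof -
    have "(cmod (f x + g x))\<^sup>2 \<le> (cmod (f x) + cmod (g x))\<^sup>2"
      by (intro power_mono norm_triangle_ineq) simp
    also have "\<dots> \<le> 2 * (cmod (f x))\<^sup>2 + 2 * (cmod (g x))\<^sup>2"
      using zero_le_power2[of "cmod (f x) - cmod (g x)"]
      by (simp add: power2_sum power2_diff)
    finally show ?thesis .
  qed
qed auto

lemma square_summable_cmult:
  fixes f :: "'a \<Rightarrow> complex"
  assumes "(\<lambda>x. (cmod (f x))\<^sup>2) summable_on UNIV"
  shows "(\<lambda>x. (cmod (c * f x))\<^sup>2) summable_on UNIV"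
  using summable_on_cmult_right[OF assms, of "(cmod c)\<^sup>2"]
  by (simp add: norm_mult power_mult_distrib)

lemma ell2_inner_summable:
  "(\<lambda>x. cnj (ell2_apply f x) * ell2_apply g x) summable_on UNIV"
proof (rule abs_summable_summable, rule Infinite_Sum.abs_summable_on_comparison_test')
  show "(\<lambda>x. (cmod (ell2_apply f x))\<^sup>2 + (cmod (ell2_apply g x))\<^sup>2) summable_on UNIV"
    by (intro summable_on_add ell2_summable)
  show "cmod (cnj (ell2_apply f x) * ell2_apply g x)
      \<le> (cmod (ell2_apply f x))\<^sup>2 + (cmod (ell2_apply g x))\<^sup>2" for x
  proof -
    have "0 \<le> cmod (ell2_apply f x) * cmod (ell2_apply g x)"
      by simp
    with sum_squares_bound[of "cmod (ell2_apply f x)" "cmod (ell2_apply g x)"]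
    show ?thesis
      unfolding norm_mult complex_mod_cnj by linarith
  qed
qed

lift_definition scaleC_ell2 :: "complex \<Rightarrow> 'a ell2 \<Rightarrow> 'a ell2" is "\<lambda>c f x. c * f x"
  by (simp add: square_summable_cmult)

definition cinner :: "'a ell2 \<Rightarrow> 'a ell2 \<Rightarrow> complex" where
  "cinner f g = (\<Sum>\<^sub>\<infinity>x. cnj (ell2_apply f x) * ell2_apply g x)"

lemma Re_cinner_self: "Re (cinner f f) = (\<Sum>\<^sub>\<infinity>x. (cmod (ell2_apply f x))\<^sup>2)"
proof -
  have "Re (cnj z * z) = (cmod z)\<^sup>2" for z
    unfolding cmod_power2 by (simp add: power2_eq_square)
  then show ?thesis
    unfolding cinner_def infsum_Re[OF ell2_inner_summable, symmetric] by presburger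
qed

lift_definition delta :: "'a \<Rightarrow> 'a ell2" is "\<lambda>t x. if x = t then 1 else 0"
proof -
  fix t :: 'a
  have "(\<lambda>x. (cmod (if x = t then 1 else 0))\<^sup>2) summable_on {t}"
    by simp
  then show "(\<lambda>x. (cmod (if x = t then 1 else 0))\<^sup>2) summable_on UNIV"
    by (rule summable_on_cong_neutral[THEN iffD1, rotated -1]) auto
qed

instantiation ell2 :: (type) real_inner
begin

lift_definition zero_ell2 :: "'a ell2" is "\<lambda>_. 0"
  by simp
lift_definition plus_ell2 :: "'a ell2 \<Rightarrow> 'a ell2 \<Rightarrow> 'a ell2" is "\<lambda>f g x. f x + g x"
  by (simp add: square_summable_add)
lift_definition uminus_ell2 :: "'a ell2 \<Rightarrow> 'a ell2" is "\<lambda>f x. - f x"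
  by simp
lift_definition minus_ell2 :: "'a ell2 \<Rightarrow> 'a ell2 \<Rightarrow> 'a ell2" is "\<lambda>f g x. f x - g x"
proof -
  fix f g :: "'a \<Rightarrow> complex"
  assume "(\<lambda>x. (cmod (f x))\<^sup>2) summable_on UNIV" "(\<lambda>x. (cmod (g x))\<^sup>2) summable_on UNIV"
  then show "(\<lambda>x. (cmod (f x - g x))\<^sup>2) summable_on UNIV"
    using square_summable_add[of f "\<lambda>x. - g x"] by simp
qed
lift_definition scaleR_ell2 :: "real \<Rightarrow> 'a ell2 \<Rightarrow> 'a ell2" is "\<lambda>r f x. of_real r * f x"
  by (rule square_summable_cmult)
definition inner_ell2 :: "'a ell2 \<Rightarrow> 'a ell2 \<Rightarrow> real" where
  "inner_ell2 f g = Re (cinner f g)"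
definition norm_ell2 :: "'a ell2 \<Rightarrow> real" where
  "norm_ell2 f = sqrt (inner f f)"
definition dist_ell2 :: "'a ell2 \<Rightarrow> 'a ell2 \<Rightarrow> real" where
  "dist_ell2 f g = norm (f - g)"
definition sgn_ell2 :: "'a ell2 \<Rightarrow> 'a ell2" where
  "sgn_ell2 f = inverse (norm f) *\<^sub>R f"
definition uniformity_ell2 :: "('a ell2 \<times> 'a ell2) filter" where
  "uniformity_ell2 = (INF e\<in>{0<..}. principal {(x, y). dist x y < e})"
definition open_ell2 :: "'a ell2 set \<Rightarrow> bool" where
  "open_ell2 U \<longleftrightarrow> (\<forall>x\<in>U. eventually (\<lambda>(x', y). x' = x \<longrightarrow> y \<in> U) uniformity)"

instance
proof
  have self: "inner f f = (\<Sum>\<^sub>\<infinity>x. (cmod (ell2_apply f x))\<^sup>2)" for f :: "'a ell2"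
    by (simp add: inner_ell2_def Re_cinner_self)
  show "inner f f = 0 \<longleftrightarrow> f = 0" for f :: "'a ell2"
  proof
    assume "inner f f = 0"
    then have "(cmod (ell2_apply f x))\<^sup>2 = 0" for x
      unfolding self by (intro nonneg_infsum_le_0D[OF _ ell2_summable]) auto
    then show "f = 0"
      by (intro ell2_eqI) (simp add: zero_ell2.rep_eq)
  qed (simp add: self zero_ell2.rep_eq)
  show "0 \<le> inner f f" for f :: "'a ell2"
    by (simp add: self infsum_nonneg)
  show "inner f g = inner g f" for f g :: "'a ell2"
    unfolding inner_ell2_def cinner_def infsum_Re[OF ell2_inner_summable, symmetric]
    by (simp add: mult.commute)
  show "inner (f + g) h = inner f h + inner g h" for f g h :: "'a ell2"
    by (simp add: inner_ell2_def cinner_def plus_ell2.rep_eq distrib_right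
        infsum_add ell2_inner_summable)
  show "inner (r *\<^sub>R f) g = r * inner f g" for r and f g :: "'a ell2"
    by (simp add: inner_ell2_def cinner_def scaleR_ell2.rep_eq mult.assoc
        infsum_cmult_right')
qed (transfer'; simp add: algebra_simps norm_ell2_def dist_ell2_def sgn_ell2_def uniformity_ell2_def
    open_ell2_def)+

end


section \<open>Complex-linear bounded operators and the weak operator topology\<close>

type_synonym 'a op = "'a ell2 \<Rightarrow>\<^sub>L 'a ell2"

text \<open>
  The library type of bounded operators consists of the real-linear ones; its norm is the operator
  norm. \<open>bounded_clinear_ops\<close> singles out the complex-linear ones, i.e. the algebra of
  bounded operators on the complex Hilbert space.
\<close>

definition bounded_clinear_ops :: "'a op set" where
  "bounded_clinear_ops = {T. \<forall>c f. blinfun_apply T (scaleC_ell2 c f) = scaleC_ell2 c (blinfun_apply T f)}"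

lemma scaleC_ell2_add_right: "scaleC_ell2 c (f + g) = scaleC_ell2 c f + scaleC_ell2 c g"
  by transfer (simp add: distrib_left)

lemma scaleC_ell2_add_left: "scaleC_ell2 (c + d) f = scaleC_ell2 c f + scaleC_ell2 d f"
  by transfer (simp add: distrib_right)

lemma scaleC_ell2_assoc: "scaleC_ell2 c (scaleC_ell2 d f) = scaleC_ell2 (c * d) f"
  by transfer (simp add: mult.assoc)

lemma scaleR_conv_scaleC_ell2: "r *\<^sub>R f = scaleC_ell2 (of_real r) f"
  by transfer simp

lemma scaleC_ell2_one: "scaleC_ell2 1 f = f"
  by transfer simp

lemma norm_ell2_squared: "(norm f)\<^sup>2 = (\<Sum>\<^sub>\<infinity>x. (cmod (ell2_apply f x))\<^sup>2)"
proof -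
  have "(norm f)\<^sup>2 = inner f f"
    by (simp add: power2_norm_eq_inner)
  also have "\<dots> = (\<Sum>\<^sub>\<infinity>x. (cmod (ell2_apply f x))\<^sup>2)"
    by (simp add: inner_ell2_def Re_cinner_self)
  finally show ?thesis .
qed

lemma norm_scaleC_ell2: "norm (scaleC_ell2 c f) = cmod c * norm f"
proof (rule power2_eq_imp_eq)
  show "(norm (scaleC_ell2 c f))\<^sup>2 = (cmod c * norm f)\<^sup>2"
    by (simp add: norm_ell2_squared power_mult_distrib scaleC_ell2.rep_eq norm_mult
        infsum_cmult_right')
qed auto

lemma bounded_linear_scaleC_ell2: "bounded_linear (scaleC_ell2 c)"
  by (rule bounded_linear_intro[where K = "cmod c"])
    (simp_all add: scaleC_ell2_add_right scaleR_conv_scaleC_ell2 scaleC_ell2_assoc norm_scaleC_ell2 mult.commute)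

definition scaleC_op :: "complex \<Rightarrow> 'a op \<Rightarrow> 'a op" where
  "scaleC_op c T = Blinfun (\<lambda>f. scaleC_ell2 c (blinfun_apply T f))"

lemma scaleC_op_apply: "blinfun_apply (scaleC_op c T) f = scaleC_ell2 c (blinfun_apply T f)"
  unfolding scaleC_op_def
  by (subst bounded_linear_Blinfun_apply)
    (auto intro: bounded_linear_compose[OF bounded_linear_scaleC_ell2] blinfun.bounded_linear_right)

interpretation complex_op: vector_space scaleC_op
  by unfold_locales
    (auto intro!: blinfun_eqI simp: scaleC_op_apply blinfun.add_left
      scaleC_ell2_add_right scaleC_ell2_add_left scaleC_ell2_assoc scaleC_ell2_one)

text \<open>
  The coarsest topology on the complex-linear bounded operators making all matrix coefficients
  \<open>T \<mapsto> \<langle>f, T g\<rangle>\<close> continuous; \<open>euclidean\<close> is here the product topology on the functions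
  \<open>'a ell2 \<times> 'a ell2 \<Rightarrow> complex\<close>.
\<close>

definition weak_operator_topology :: "'a op topology" where
  "weak_operator_topology =
     pullback_topology bounded_clinear_ops (\<lambda>T (f, g). cinner f (blinfun_apply T g)) euclidean"


section \<open>Twisted group von Neumann algebras\<close>

text \<open>
  The extension of \<open>\<delta>\<^sub>t \<mapsto> \<omega>(s,t) \<delta>\<^sub>s\<^sub>t\<close> to all square-summable functions. It is a bounded operator
  if \<open>\<omega>\<close> takes values in the unit circle, which is the only case of interest.
\<close>

definition twisted_translation :: "('g::group_add \<Rightarrow> 'g \<Rightarrow> complex) \<Rightarrow> 'g \<Rightarrow> 'g op" where
  "twisted_translation \<omega> s =
     Blinfun (\<lambda>f. Abs_ell2 (\<lambda>x. \<omega> s (- s + x) * ell2_apply f (- s + x)))"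

lemma
  fixes \<omega> :: "'g::group_add \<Rightarrow> 'g \<Rightarrow> complex"
  assumes "\<And>s t. cmod (\<omega> s t) = 1"
  shows twisted_translation_apply: "ell2_apply (blinfun_apply (twisted_translation \<omega> s) f) x
      = \<omega> s (- s + x) * ell2_apply f (- s + x)"
    and norm_twisted_translation_apply: "norm (blinfun_apply (twisted_translation \<omega> s) f) = norm f"
proof -
  define T where "T = (\<lambda>f. Abs_ell2 (\<lambda>x. \<omega> s (- s + x) * ell2_apply f (- s + x)))"
  have bij: "bij_betw (\<lambda>x. - s + x) UNIV UNIV"
    by (rule bij_betw_byWitness[where f' = "\<lambda>x. s + x"]) (auto simp: add.assoc[symmetric])
  have "(\<lambda>x. (cmod (\<omega> s (- s + x) * ell2_apply f (- s + x)))\<^sup>2) summable_on UNIV" for f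
    using summable_on_reindex_bij_betw[OF bij, of "\<lambda>x. (cmod (ell2_apply f x))\<^sup>2"]
    by (simp add: norm_mult assms ell2_summable)
  then have T: "ell2_apply (T f) x = \<omega> s (- s + x) * ell2_apply f (- s + x)" for f x
    by (simp add: T_def Abs_ell2_inverse)
  have "(norm (T f))\<^sup>2 = (norm f)\<^sup>2" for f
    using infsum_reindex_bij_betw[OF bij, of "\<lambda>x. (cmod (ell2_apply f x))\<^sup>2"]
    by (simp add: norm_ell2_squared T norm_mult assms)
  then have norm: "norm (T f) = norm f" for f
    by (simp add: power2_eq_iff_nonneg)
  have "bounded_linear T"
    by (rule bounded_linear_intro[where K = 1])
      (auto intro!: ell2_eqI simp: T norm plus_ell2.rep_eq scaleR_ell2.rep_eq algebra_simps)
  then have "blinfun_apply (twisted_translation \<omega> s) = T"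
    by (simp add: twisted_translation_def T_def bounded_linear_Blinfun_apply)
  then show "ell2_apply (blinfun_apply (twisted_translation \<omega> s) f) x
      = \<omega> s (- s + x) * ell2_apply f (- s + x)"
    and "norm (blinfun_apply (twisted_translation \<omega> s) f) = norm f"
    by (simp_all add: T norm)
qed

lemma twisted_translation_delta:
  assumes "\<And>s t. cmod (\<omega> s t) = 1"
  shows "blinfun_apply (twisted_translation \<omega> s) (delta t) = scaleC_ell2 (\<omega> s t) (delta (s + t))"
proof (rule ell2_eqI)
  fix x
  have "- s + x = t \<longleftrightarrow> x = s + t"
    by (metis add.assoc add.left_inverse add.right_inverse add_0)
  then show "ell2_apply (blinfun_apply (twisted_translation \<omega> s) (delta t)) x
      = ell2_apply (scaleC_ell2 (\<omega> s t) (delta (s + t))) x"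
    by (auto simp: twisted_translation_apply assms delta.rep_eq scaleC_ell2.rep_eq)
qed

lemma twisted_translation_clinear:
  assumes "\<And>s t. cmod (\<omega> s t) = 1"
  shows "twisted_translation \<omega> s \<in> bounded_clinear_ops"
  by (auto simp: bounded_clinear_ops_def twisted_translation_apply assms scaleC_ell2.rep_eq
      intro!: ell2_eqI)

definition twisted_vN_algebra :: "('g::group_add \<Rightarrow> 'g \<Rightarrow> complex) \<Rightarrow> 'g op set" where
  "twisted_vN_algebra \<omega> =
     weak_operator_topology closure_of (complex_op.span (range (twisted_translation \<omega>)))"

lemma twisted_translation_in_twisted_vN_algebra:
  assumes "\<And>s t. cmod (\<omega> s t) = 1"
  shows "twisted_translation \<omega> s \<in> twisted_vN_algebra \<omega>"
  unfolding twisted_vN_algebra_def in_closure_of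
  using twisted_translation_clinear[of \<omega> s, OF assms]
    complex_op.span_base[of "twisted_translation \<omega> s" "range (twisted_translation \<omega>)"]
  by (force simp: weak_operator_topology_def topspace_pullback_topology)

definition GL :: "'a op set \<Rightarrow> 'a op set" where
  "GL B = {T \<in> B. \<exists>S\<in>B. T o\<^sub>L S = id_blinfun \<and> S o\<^sub>L T = id_blinfun}"

definition homs_into_GL :: "'a op set \<Rightarrow> ('g::group_add \<Rightarrow> 'a op) set" where
  "homs_into_GL B = {\<pi>. (\<forall>s. \<pi> s \<in> GL B) \<and> (\<forall>s t. \<pi> (s + t) = \<pi> s o\<^sub>L \<pi> t)}"

definition exp_cocycle :: "('g::group_add \<Rightarrow> 'g \<Rightarrow> real) \<Rightarrow> nat \<Rightarrow> 'g \<Rightarrow> 'g \<Rightarrow> complex" where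
  "exp_cocycle \<sigma> n s t = exp (2 * of_real pi * \<i> * of_real (\<sigma> s t) / of_nat n)"

lemma norm_exp_cocycle: "cmod (exp_cocycle \<sigma> n s t) = 1"
  by (simp add: exp_cocycle_def)

end

theory Submission
  imports Defs
begin

text \<open>
  Suppose \<open>\<rho>\<^sub>n(s) = \<pi>\<^sub>n(s) x\<^sub>n(s)\<close> with \<open>\<pi>\<^sub>n\<close> multiplicative and \<open>x\<^sub>n(s) \<rightarrow> 1\<close>. Then
  \<open>(\<pi>\<^sub>n(b)\<^sup>-\<^sup>1 x\<^sub>n(a) \<pi>\<^sub>n(b)) x\<^sub>n(b) = \<omega>\<^sub>n(a,b) x\<^sub>n(ab)\<close>. Near \<open>1\<close> the function \<open>\<tau> \<circ> log\<close>, with \<open>\<tau>\<close> the canonical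
  trace, is additive on products and invariant under conjugation, so for large \<open>n\<close> (depending on
  \<open>a\<close> and \<open>b\<close>) the imaginary part of \<open>n \<tau>(log x\<^sub>n(s)) / 2\<pi>\<close> is a cochain whose coboundary is
  \<open>\<sigma>\<close> at \<open>(a, b)\<close>. These cochains need not converge, but the coboundary equation for \<open>\<sigma>\<close> is a real
  linear system in which every finite subsystem is solvable, hence it is solvable.
\<close>

section \<open>Finitely many cocycle equations at a time\<close>

text \<open>Real-linear independence makes the span of the \<open>delta s\<close> a copy of the free
  real vector space on the index set, so that arbitrary real functions become linear
  functionals.\<close>

lemma independent_delta: "independent (range (delta :: 'a \<Rightarrow> 'a ell2))"
proof (rule pairwise_orthogonal_independent)
  have "inner (delta s) (delta t) = 0" if "s \<noteq> t" for s t :: 'a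
  proof -
    have "cinner (delta s) (delta t) = 0"
      unfolding cinner_def by (rule infsum_0) (use that in \<open>auto simp: delta.rep_eq\<close>)
    then show ?thesis by (simp add: inner_ell2_def)
  qed
  then show "pairwise orthogonal (range (delta :: 'a \<Rightarrow> 'a ell2))"
    unfolding pairwise_def orthogonal_def by (metis rangeE)
  show "0 \<notin> range (delta :: 'a \<Rightarrow> 'a ell2)"
  proof
    assume "0 \<in> range (delta :: 'a \<Rightarrow> 'a ell2)"
    then obtain t :: 'a where "delta t = 0" by auto
    then have "ell2_apply (delta t) t = ell2_apply 0 t" by simp
    then show False by (simp add: delta.rep_eq zero_ell2.rep_eq)
  qed
qed

lemma inj_delta: "inj (delta :: 'a \<Rightarrow> 'a ell2)"
proof (rule injI)
  fix s t :: 'a assume "delta s = delta t"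
  then have "ell2_apply (delta s) s = ell2_apply (delta t) s" by simp
  then show "s = t" by (simp add: delta.rep_eq split: if_splits)
qed

lemma linear_extend_delta:
  fixes \<gamma> :: "'a \<Rightarrow> real"
  shows "\<exists>g :: 'a ell2 \<Rightarrow> real. linear g \<and> (\<forall>s. g (delta s) = \<gamma> s)"
proof -
  obtain g :: "'a ell2 \<Rightarrow> real" where "linear g" "\<forall>x\<in>range delta. g x = (\<gamma> \<circ> inv delta) x"
    using linear_independent_extend[OF independent_delta] by metis
  then show ?thesis by (auto simp: inj_delta intro!: exI[of _ g])
qed

text \<open>
  A function \<open>\<gamma>\<close> is a linear functional on the real span of the vectors \<open>\<delta>\<^sub>s\<close>, and the coboundary
  equation for the pair \<open>(a, b)\<close> prescribes its value at \<open>\<delta>\<^sub>a - \<delta>\<^sub>a\<^sub>b + \<delta>\<^sub>b\<close>. A linear relation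
  between such vectors involves only finitely many pairs, so these values are consistent.
\<close>

lemma two_coboundary_if_finitely:
  fixes \<sigma> :: "'g::group_add \<Rightarrow> 'g \<Rightarrow> real"
  assumes fin: "\<And>F. finite F \<Longrightarrow> \<exists>\<gamma>. \<forall>(a, b)\<in>F. \<sigma> a b = \<gamma> a - \<gamma> (a + b) + \<gamma> b"
  shows "\<sigma> \<in> two_coboundaries"
proof -
  define v where "v = (\<lambda>(a, b). delta a - delta (a + b) + delta b :: 'g ell2)"
  \<comment> \<open>\<open>f\<close> will be prescribed only on a basis \<open>B\<close> of the span
    of \<open>range v\<close>, through one chosen pair \<open>r w\<close> for each basis vector
    \<open>w\<close>; the equations at all other pairs have to follow by linearity.\<close>
  obtain B where B: "B \<subseteq> range v" "independent B" "range v \<subseteq> span B"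
    using maximal_independent_subset by blast
  define r where "r = inv v"
  have r: "v (r w) = w" if "w \<in> B" for w
    unfolding r_def using B that by (metis f_inv_into_f subsetD)
  obtain f :: "'g ell2 \<Rightarrow> real" where f: "linear f" "\<And>w. w \<in> B \<Longrightarrow> f w = case_prod \<sigma> (r w)"
    using linear_independent_extend[OF B(2), of "\<lambda>w. case_prod \<sigma> (r w)"] by auto
  have "\<sigma> a b = f (delta a) - f (delta (a + b)) + f (delta b)" for a b
  proof -
    have "v (a, b) \<in> span B" using B by auto
    then obtain T where T: "finite T" "T \<subseteq> B" "v (a, b) \<in> span T"
      unfolding span_explicit by auto
    \<comment> \<open>With \<open>(a, b)\<close> included among the finitely many equations, a
      single \<open>g\<close> agrees with \<open>f\<close> on \<open>T\<close> and also takes the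
      value \<open>\<sigma> a b\<close> at \<open>v (a, b)\<close>.\<close>
    obtain \<gamma> where \<gamma>: "\<forall>(a, b)\<in>insert (a, b) (r ` T). \<sigma> a b = \<gamma> a - \<gamma> (a + b) + \<gamma> b"
      using fin T(1) by (meson finite_imageI finite_insert)
    obtain g :: "'g ell2 \<Rightarrow> real" where g: "linear g" "\<And>s. g (delta s) = \<gamma> s"
      using linear_extend_delta by metis
    have gv: "g (v p) = case_prod \<sigma> p" if "p \<in> insert (a, b) (r ` T)" for p
      using \<gamma> that by (cases p) (force simp: v_def linear_add[OF g(1)] linear_diff[OF g(1)] g(2))
    have "f w = g w" if "w \<in> T" for w
    proof -
      have "g (v (r w)) = case_prod \<sigma> (r w)" using gv that by blast
      then show ?thesis using r f that T by auto
    qed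
    then have "f (v (a, b)) = g (v (a, b))"
      using T(3) f(1) g(1) linear_eq_on by blast
    also have "\<dots> = \<sigma> a b" using gv by auto
    finally show ?thesis by (simp add: v_def linear_add[OF f(1)] linear_diff[OF f(1)])
  qed
  then show ?thesis
    unfolding two_coboundaries_def by (intro CollectI exI[of _ "f \<circ> delta"]) simp
qed

section \<open>The logarithm under a trace\<close>

lemma sum_powers_mult_left:
  fixes a :: "'a::ring_1"
  shows "(1 - a) * (\<Sum>k<n. a ^ k) = 1 - a ^ n"
  by (induction n) (simp_all add: distrib_left left_diff_distrib)

lemma sum_powers_mult_right:
  fixes a :: "'a::ring_1"
  shows "(\<Sum>k<n. a ^ k) * (1 - a) = 1 - a ^ n"
proof (induction n)
  case (Suc n)
  have "(\<Sum>k<Suc n. a ^ k) * (1 - a) = (1 - a ^ n) + a ^ n * (1 - a)"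
    by (simp only: sum.lessThan_Suc distrib_right Suc.IH)
  then show ?case by (simp add: right_diff_distrib power_commutes)
qed simp

lemma norm_sum_powers_le:
  fixes a :: "'a::real_normed_algebra_1"
  assumes "norm a \<le> r" "r < 1"
  shows "norm (\<Sum>k<n. a ^ k) \<le> 1 / (1 - r)"
proof -
  have "0 \<le> r" using assms norm_ge_zero order_trans by blast
  have "norm (\<Sum>k<n. a ^ k) \<le> (\<Sum>k<n. r ^ k)"
    by (rule sum_norm_le) (meson assms(1) norm_ge_zero norm_power_ineq order_trans power_mono)
  also have "\<dots> = (1 - r ^ n) / (1 - r)"
    using assms by (simp add: sum_gp_strict)
  also have "\<dots> \<le> 1 / (1 - r)"
    using assms \<open>0 \<le> r\<close> by (intro divide_right_mono) auto
  finally show ?thesis .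
qed

text \<open>The Leibniz rule leaves \<open>p'\<close> in each of the \<open>n\<close> positions,
  since \<open>p'\<close> need not commute with \<open>p t\<close>; a trace will merge the
  summands.\<close>

lemma has_vector_derivative_power_noncomm:
  fixes p :: "real \<Rightarrow> 'a::real_normed_algebra_1"
  assumes "(p has_vector_derivative p') (at t within S)"
  shows "((\<lambda>t. p t ^ n) has_vector_derivative (\<Sum>i<n. p t ^ i * p' * p t ^ (n - Suc i))) (at t within S)"
proof (induction n)
  case (Suc n)
  show ?case
    using has_vector_derivative_mult[OF assms Suc.IH]
    by (simp add: sum.lessThan_Suc_shift sum_distrib_left mult.assoc add.commute del: sum.lessThan_Suc)
qed simp

text \<open>The trace identity is asked on a carrier \<open>A\<close> only: in the application the
  ambient type consists of all bounded operators, and the identity is established on a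
  subalgebra.\<close>

locale traced_algebra =
  fixes A :: "'a::real_normed_algebra_1 set" and \<tau> :: "'a \<Rightarrow> complex"
  assumes one_closed: "1 \<in> A"
    and diff_closed: "a \<in> A \<Longrightarrow> b \<in> A \<Longrightarrow> a - b \<in> A"
    and mult_closed: "a \<in> A \<Longrightarrow> b \<in> A \<Longrightarrow> a * b \<in> A"
    and scaleR_closed: "a \<in> A \<Longrightarrow> c *\<^sub>R a \<in> A"
    and trace_bounded_linear: "bounded_linear \<tau>"
    and trace_commute: "a \<in> A \<Longrightarrow> b \<in> A \<Longrightarrow> \<tau> (a * b) = \<tau> (b * a)"
begin

lemma add_closed: "a \<in> A \<Longrightarrow> b \<in> A \<Longrightarrow> a + b \<in> A"
  using diff_closed[of a "(-1) *\<^sub>R b"] scaleR_closed[of b "-1"] by simp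

lemma power_closed: "a \<in> A \<Longrightarrow> a ^ n \<in> A"
  by (induction n) (auto simp: one_closed mult_closed)

lemma sum_closed: "(\<And>i. i \<in> I \<Longrightarrow> f i \<in> A) \<Longrightarrow> sum f I \<in> A"
proof (induction I rule: infinite_finite_induct)
  case (infinite I) then show ?case using diff_closed[OF one_closed one_closed] by simp
next
  case empty then show ?case using diff_closed[OF one_closed one_closed] by simp
qed (auto intro: add_closed)

lemmas closed = one_closed diff_closed mult_closed scaleR_closed add_closed power_closed sum_closed

text \<open>The power series of \<open>- \<tau> (log (1 - u))\<close>.\<close>

definition trace_log :: "'a \<Rightarrow> complex" where
  "trace_log u = (\<Sum>k. \<tau> (u ^ Suc k) / of_nat (Suc k))"

lemma summable_trace_log:
  assumes "norm u < 1"
  shows "summable (\<lambda>k. \<tau> (u ^ Suc k) / of_nat (Suc k))"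
proof -
  obtain K where K: "\<And>a. cmod (\<tau> a) \<le> norm a * K"
    using bounded_linear.bounded[OF trace_bounded_linear] by blast
  have K0: "0 \<le> K" using K[of 1] norm_ge_zero[of "\<tau> 1"] by (simp del: norm_ge_zero)
  show ?thesis
  proof (rule summable_comparison_test)
    show "summable (\<lambda>k. norm u ^ Suc k * K)"
      using assms by (intro summable_mult2 summable_geometric[THEN summable_ignore_initial_segment[of _ 1, simplified]]) auto
    have "cmod (\<tau> (u ^ Suc k) / of_nat (Suc k)) \<le> norm u ^ Suc k * K" for k
    proof -
      have "cmod (\<tau> (u ^ Suc k) / of_nat (Suc k)) \<le> cmod (\<tau> (u ^ Suc k))"
        using mult_right_mono[of 1 "real (Suc k)" "cmod (\<tau> (u ^ Suc k))"]
        by (simp add: norm_divide pos_divide_le_eq mult.commute del: of_nat_Suc power_Suc)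
      also have "\<dots> \<le> norm (u ^ Suc k) * K" by (rule K)
      also have "\<dots> \<le> norm u ^ Suc k * K" by (intro mult_right_mono norm_power_ineq K0)
      finally show ?thesis .
    qed
    then show "\<exists>N. \<forall>k\<ge>N. cmod (\<tau> (u ^ Suc k) / of_nat (Suc k)) \<le> norm u ^ Suc k * K" by blast
  qed
qed

text \<open>Cyclicity turns each of the \<open>Suc k\<close> Leibniz summands into
  \<open>\<tau> (p t ^ k * p')\<close>, and the divisor \<open>Suc k\<close> cancels their
  number.\<close>

lemma has_vector_derivative_trace_power:
  assumes p: "(p has_vector_derivative p') (at t within S)" and A: "p t \<in> A" "p' \<in> A"
  shows "((\<lambda>t. \<tau> (p t ^ Suc k) / of_nat (Suc k)) has_vector_derivative \<tau> (p t ^ k * p')) (at t within S)"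
proof -
  interpret \<tau>: bounded_linear \<tau> by (rule trace_bounded_linear)
  have "\<tau> (p t ^ i * p' * p t ^ (Suc k - Suc i)) = \<tau> (p t ^ k * p')" if "i < Suc k" for i
  proof -
    have "\<tau> (p t ^ i * p' * p t ^ (Suc k - Suc i)) = \<tau> (p t ^ (k - i) * (p t ^ i * p'))"
      using A by (simp add: trace_commute closed)
    also have "\<dots> = \<tau> (p t ^ k * p')"
      using that by (simp add: mult.assoc[symmetric] power_add[symmetric])
    finally show ?thesis .
  qed
  then have *: "\<tau> (\<Sum>i<Suc k. p t ^ i * p' * p t ^ (Suc k - Suc i)) = of_nat (Suc k) * \<tau> (p t ^ k * p')"
    unfolding \<tau>.sum by (subst sum.cong[OF refl, where h = "\<lambda>_. \<tau> (p t ^ k * p')"]) auto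
  show ?thesis
    using has_vector_derivative_divide[OF \<tau>.has_vector_derivative[OF has_vector_derivative_power_noncomm[OF p, of "Suc k"]], of "of_nat (Suc k)"]
    unfolding * by (simp del: of_nat_Suc power_Suc)
qed

text \<open>
  With \<open>x = 1 - t u\<close> and \<open>y = 1 - t v\<close>, the derivative of \<open>\<tau> (log (x y)) - \<tau> (log x) - \<tau> (log y)\<close>
  in \<open>t\<close> is \<open>\<tau> ((x y)\<^sup>-\<^sup>1 (x' y + x y') - x\<^sup>-\<^sup>1 x' - y\<^sup>-\<^sup>1 y')\<close>, which vanishes by cyclicity. As the algebra
  need not be complete, the inverses are replaced by partial sums of the Neumann series.
\<close>

lemma trace_log_mult:
  assumes A: "u \<in> A" "v \<in> A" and small: "norm u \<le> 1/4" "norm v \<le> 1/4"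
  shows "trace_log (1 - (1 - u) * (1 - v)) = trace_log u + trace_log v"
proof -
  interpret \<tau>: bounded_linear \<tau> by (rule trace_bounded_linear)
  obtain K where K0: "0 \<le> K" and K: "\<And>a. cmod (\<tau> a) \<le> norm a * K"
    using \<tau>.nonneg_bounded by blast
  define p where "p = (\<lambda>t. 1 - (1 - t *\<^sub>R u) * (1 - t *\<^sub>R v))"
  define p' where "p' = (\<lambda>t. u * (1 - t *\<^sub>R v) + (1 - t *\<^sub>R u) * v)"
  \<comment> \<open>\<open>G N\<close> is a partial sum of the difference of the three logarithm
    series along the rays \<open>t *\<^sub>R u\<close> and \<open>t *\<^sub>R v\<close>;
    \<open>G' N\<close> is its derivative.\<close>
  define G where "G = (\<lambda>N t. \<Sum>k<N. \<tau> (p t ^ Suc k) / of_nat (Suc k)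
      - \<tau> ((t *\<^sub>R u) ^ Suc k) / of_nat (Suc k) - \<tau> ((t *\<^sub>R v) ^ Suc k) / of_nat (Suc k))"
  define G' where "G' = (\<lambda>N t. \<Sum>k<N. \<tau> (p t ^ k * p' t) - \<tau> ((t *\<^sub>R u) ^ k * u) - \<tau> ((t *\<^sub>R v) ^ k * v))"
  have pA: "p t \<in> A" "p' t \<in> A" for t
    using A by (auto simp: p_def p'_def intro!: closed)
  have lin: "((\<lambda>t. t *\<^sub>R a) has_vector_derivative a) (at t within S)" for a :: 'a and t S
    by (auto intro!: derivative_eq_intros)
  have lin': "((\<lambda>t. 1 - t *\<^sub>R a) has_vector_derivative - a) (at t within S)" for a :: 'a and t S
    by (auto intro!: derivative_eq_intros)
  have p: "(p has_vector_derivative p' t) (at t within S)" for t S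
    using has_vector_derivative_diff[OF has_vector_derivative_const has_vector_derivative_mult[OF lin' lin']]
    unfolding p_def p'_def by simp
  have G: "(G N has_vector_derivative G' N t) (at t within S)" for N t S
    unfolding G_def G'_def
    by (intro has_vector_derivative_sum has_vector_derivative_diff
        has_vector_derivative_trace_power p lin pA closed A)
  have small_t: "norm (t *\<^sub>R a) \<le> 1/4" if "norm a \<le> 1/4" "0 \<le> t" "t \<le> 1" for a :: 'a and t
    using that mult_mono[of t 1 "norm a" "1/4"] by simp
  have prod_bound: "norm (a * b) \<le> \<alpha> * \<beta>" if "norm a \<le> \<alpha>" "norm b \<le> \<beta>" for a b :: 'a and \<alpha> \<beta>
    using norm_mult_ineq[of a b] mult_mono[OF that] norm_ge_zero[of a] norm_ge_zero[of b] that
    by (smt (verit))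
  have power_bound: "norm (a ^ N) \<le> (9/16) ^ N" if "norm a \<le> 9/16" for a :: 'a and N
    using norm_power_ineq[of a N] power_mono[OF that norm_ge_zero, of N] by linarith
  \<comment> \<open>Two remainders contribute \<open>2 * 3 + 3 = 9\<close> times
    \<open>(9/16) ^ N\<close> each, whence 18; the norms of \<open>u\<close> and \<open>v\<close>
    are estimated by 1.\<close>
  have G'_bound: "cmod (G' N t) \<le> 18 * ((9/16) ^ N * K)" if t: "0 \<le> t" "t \<le> 1" for N t
  proof -
    define x y where "x = 1 - t *\<^sub>R u" and "y = 1 - t *\<^sub>R v"
    define X Y P where "X = (\<Sum>k<N. (t *\<^sub>R u) ^ k)" and "Y = (\<Sum>k<N. (t *\<^sub>R v) ^ k)"
      and "P = (\<Sum>k<N. p t ^ k)"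
    have xyA: "x \<in> A" "y \<in> A" "X \<in> A" "Y \<in> A" "P \<in> A"
      using A pA by (auto simp: x_def y_def X_def Y_def P_def intro!: closed)
    have tu: "norm (t *\<^sub>R u) \<le> 1/4" and tv: "norm (t *\<^sub>R v) \<le> 1/4"
      using small t small_t by auto
    have nx: "norm x \<le> 2" and ny: "norm y \<le> 2"
      using norm_triangle_ineq4[of 1 "t *\<^sub>R u"] norm_triangle_ineq4[of 1 "t *\<^sub>R v"] tu tv
      by (simp_all add: x_def y_def del: norm_scaleR)
    \<comment> \<open>\<open>9/16 = 1/4 + 1/4 + 1/4 * 1/4\<close>, so the path stays inside the disc
      of convergence.\<close>
    have np: "norm (p t) \<le> 9/16"
    proof -
      have "p t = t *\<^sub>R u + t *\<^sub>R v - (t *\<^sub>R u) * (t *\<^sub>R v)" by (simp add: p_def algebra_simps)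
      then have "norm (p t) \<le> norm (t *\<^sub>R u) + norm (t *\<^sub>R v) + norm ((t *\<^sub>R u) * (t *\<^sub>R v))"
        by (metis (no_types, lifting) add_right_mono norm_triangle_ineq norm_triangle_ineq4 order_trans)
      then show ?thesis using prod_bound[OF tu tv] tu tv by linarith
    qed
    \<comment> \<open>Both \<open>1 / (1 - 9/16) = 16/7\<close> and
      \<open>1 / (1 - 1/4) = 4/3\<close> are below 3.\<close>
    have nX: "norm X \<le> 3" and nY: "norm Y \<le> 3" and nP: "norm P \<le> 3"
      unfolding X_def Y_def P_def
      using norm_sum_powers_le[OF np, of N] norm_sum_powers_le[OF tu, of N] norm_sum_powers_le[OF tv, of N]
      by (simp_all del: norm_scaleR)
    have XN: "X * x = 1 - (t *\<^sub>R u) ^ N" "y * Y = 1 - (t *\<^sub>R v) ^ N"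
      "x * y * P = 1 - p t ^ N" "P * (x * y) = 1 - p t ^ N"
      using sum_powers_mult_right[of "t *\<^sub>R u" N] sum_powers_mult_left[of "t *\<^sub>R v" N]
        sum_powers_mult_left[of "p t" N] sum_powers_mult_right[of "p t" N]
      by (simp_all add: x_def y_def X_def Y_def P_def p_def)
    \<comment> \<open>\<open>X\<close> is an approximate left inverse of \<open>x\<close> and
      \<open>y * P\<close> an approximate right inverse; evaluating \<open>X * (x * y * P)\<close>
      in two ways compares them up to \<open>N\<close>-th powers.\<close>
    have "y * P - X = (t *\<^sub>R u) ^ N * (y * P) - X * p t ^ N"
    proof -
      have "X * (x * y * P) = (X * x) * (y * P)" by (simp add: mult.assoc)
      then show ?thesis unfolding XN by (simp add: algebra_simps)
    qed
    moreover have "norm ((t *\<^sub>R u) ^ N * (y * P)) \<le> (9/16) ^ N * (2 * 3)"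
      using tu by (intro prod_bound power_bound ny nP) auto
    moreover have "norm (X * p t ^ N) \<le> 3 * (9/16) ^ N"
      by (intro prod_bound power_bound nX np)
    ultimately have 1: "norm (y * P - X) \<le> 9 * (9/16) ^ N"
      using norm_triangle_ineq4[of "(t *\<^sub>R u) ^ N * (y * P)" "X * p t ^ N"] by simp
    have "P * x - Y = P * x * (t *\<^sub>R v) ^ N - p t ^ N * Y"
    proof -
      have "P * (x * y) * Y = P * x * (y * Y)" by (simp add: mult.assoc)
      then show ?thesis unfolding XN by (simp add: algebra_simps)
    qed
    moreover have "norm (P * x * (t *\<^sub>R v) ^ N) \<le> 3 * 2 * (9/16) ^ N"
      using tv by (intro prod_bound power_bound nx nP) auto
    moreover have "norm (p t ^ N * Y) \<le> (9/16) ^ N * 3"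
      by (intro prod_bound power_bound nY np)
    ultimately have 2: "norm (P * x - Y) \<le> 9 * (9/16) ^ N"
      using norm_triangle_ineq4[of "P * x * (t *\<^sub>R v) ^ N" "p t ^ N * Y"] by simp
    have "G' N t = \<tau> (P * p' t) - \<tau> (X * u) - \<tau> (Y * v)"
      by (simp add: G'_def P_def X_def Y_def sum_subtractf sum_distrib_right \<tau>.sum)
    also have "\<tau> (P * p' t) = \<tau> ((P * u) * y) + \<tau> ((P * x) * v)"
      by (simp add: p'_def x_def y_def \<tau>.add[symmetric] algebra_simps)
    \<comment> \<open>Cyclicity moves \<open>y\<close> to the front, where \<open>y * P\<close> can
      be compared with \<open>X\<close>.\<close>
    also have "\<tau> ((P * u) * y) = \<tau> (y * (P * u))"
      using A xyA by (intro trace_commute closed)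
    finally have "G' N t = \<tau> ((y * P - X) * u) + \<tau> ((P * x - Y) * v)"
      by (simp add: \<tau>.diff algebra_simps)
    then have "cmod (G' N t) \<le> cmod (\<tau> ((y * P - X) * u)) + cmod (\<tau> ((P * x - Y) * v))"
      by (simp only: norm_triangle_ineq)
    moreover have B: "cmod (\<tau> (a * b)) \<le> 9 * ((9/16) ^ N * K)"
      if "norm a \<le> 9 * (9/16) ^ N" "norm b \<le> 1/4" for a b
    proof -
      have "norm b \<le> 1" using that(2) by simp
      from mult_right_mono[OF prod_bound[OF that(1) this] K0]
      have "norm (a * b) * K \<le> 9 * (9/16) ^ N * K" by (simp only: mult_1_right)
      with K[of "a * b"] show ?thesis
        unfolding mult.assoc by (rule order_trans)
    qed
    ultimately show ?thesis
      using B[OF 1 small(1)] B[OF 2 small(2)] by linarith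
  qed
  have G1: "cmod (G N 1) \<le> 18 * ((9/16) ^ N * K)" for N
  proof -
    have "norm (G N 1 - G N 0) \<le> 18 * ((9/16) ^ N * K) * norm (1 - 0 :: real)"
    proof (rule differentiable_bound[of "{0..1}"])
      show "(G N has_derivative (\<lambda>h. h *\<^sub>R G' N t)) (at t within {0..1})" for t
        using G by (simp add: has_vector_derivative_def)
      show "onorm (\<lambda>h. h *\<^sub>R G' N t) \<le> 18 * ((9/16) ^ N * K)" if "t \<in> {0..1}" for t
        using mult_right_mono[OF G'_bound[of t N] abs_ge_zero] that
        by (intro onorm_le) (simp only: norm_scaleR real_norm_def mult.commute[of "\<bar>_\<bar>"] atLeastAtMost_iff)
    qed (simp_all only: convex_real_interval atLeastAtMost_iff, simp_all)
    moreover have "G N 0 = 0" by (simp add: G_def p_def)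
    ultimately show ?thesis by (simp only: diff_zero norm_one mult_1_right)
  qed
  have "(\<lambda>N. 18 * ((9/16) ^ N * K)) \<longlonglongrightarrow> 0"
    by (rule tendsto_mult_right_zero, rule tendsto_mult_left_zero, rule LIMSEQ_power_zero) simp
  then have lim: "(\<lambda>N. G N 1) \<longlonglongrightarrow> 0"
    by (rule Lim_null_comparison[rotated]) (intro always_eventually allI G1)
  have np: "norm (p 1) < 1"
  proof -
    have "p 1 = u + v - u * v" by (simp add: p_def algebra_simps)
    then have "norm (p 1) \<le> norm u + norm v + norm (u * v)"
      by (metis (no_types, lifting) add_right_mono norm_triangle_ineq norm_triangle_ineq4 order_trans)
    then show ?thesis using prod_bound[OF small] small by linarith
  qed
  \<comment> \<open>\<open>G N 1\<close> tends to 0 by the derivative bound and, as a partial sum,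
    to the difference of the values of \<open>trace_log\<close>, which is therefore 0.\<close>
  have "(\<lambda>k. \<tau> (p 1 ^ Suc k) / of_nat (Suc k) - \<tau> ((1 *\<^sub>R u) ^ Suc k) / of_nat (Suc k) - \<tau> ((1 *\<^sub>R v) ^ Suc k) / of_nat (Suc k))
      sums (trace_log (p 1) - trace_log u - trace_log v)"
    unfolding trace_log_def scaleR_one using np small
    by (intro sums_diff summable_sums summable_trace_log) auto
  then have "(\<lambda>N. G N 1) \<longlonglongrightarrow> trace_log (p 1) - trace_log u - trace_log v"
    by (simp add: sums_def G_def)
  then have "trace_log (p 1) - trace_log u - trace_log v = 0"
    using lim LIMSEQ_unique by blast
  then show ?thesis by (simp add: p_def algebra_simps)
qed

text \<open>Conjugation passes through powers and disappears under \<open>\<tau>\<close>, so the two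
  series agree term by term.\<close>

lemma trace_log_conjugate:
  assumes "q \<in> A" "q' \<in> A" "u \<in> A" "q * q' = 1" "q' * q = 1"
  shows "trace_log (q' * u * q) = trace_log u"
proof -
  have "(q' * u * q) ^ n = q' * u ^ n * q" for n
  proof (induction n)
    case (Suc n)
    have "(q' * u * q) ^ Suc n = (q' * u * q) * (q' * u ^ n * q)"
      by (simp only: power_Suc Suc.IH)
    also have "\<dots> = q' * u * (q * q') * u ^ n * q"
      by (simp only: mult.assoc)
    finally have "(q' * u * q) ^ Suc n = q' * u * (q * q') * u ^ n * q" .
    then show ?case by (simp add: assms mult.assoc)
  qed (simp add: assms)
  moreover have "\<tau> (q' * u ^ n * q) = \<tau> (u ^ n)" for n
  proof -
    have "\<tau> (q' * u ^ n * q) = \<tau> (q * (q' * u ^ n))" using assms by (intro trace_commute closed)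
    also have "\<dots> = \<tau> (u ^ n)" by (simp add: mult.assoc[symmetric] assms)
    finally show ?thesis .
  qed
  ultimately show ?thesis by (simp add: trace_log_def del: power_Suc)
qed

end

section \<open>Bounded operators as a normed algebra\<close>

text \<open>A copy of the operator type on which composition can be declared as multiplication,
  giving powers and the class \<open>real_normed_algebra_1\<close>. The sort
  \<open>perfect_space\<close> in the instance excludes the zero space, where the identity would be
  0.\<close>

typedef (overloaded) 'a endo = "UNIV :: ('a::real_normed_vector \<Rightarrow>\<^sub>L 'a) set"
  morphisms endo_blinfun Endo ..

setup_lifting type_definition_endo

instantiation endo :: ("{real_normed_vector, perfect_space}") real_normed_algebra_1
begin

lift_definition zero_endo :: "'a endo" is 0 .
lift_definition one_endo :: "'a endo" is id_blinfun .
lift_definition plus_endo :: "'a endo \<Rightarrow> 'a endo \<Rightarrow> 'a endo" is "(+)" .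
lift_definition uminus_endo :: "'a endo \<Rightarrow> 'a endo" is uminus .
lift_definition minus_endo :: "'a endo \<Rightarrow> 'a endo \<Rightarrow> 'a endo" is "(-)" .
lift_definition times_endo :: "'a endo \<Rightarrow> 'a endo \<Rightarrow> 'a endo" is "(o\<^sub>L)" .
lift_definition scaleR_endo :: "real \<Rightarrow> 'a endo \<Rightarrow> 'a endo" is "(*\<^sub>R)" .
lift_definition norm_endo :: "'a endo \<Rightarrow> real" is norm .
definition dist_endo :: "'a endo \<Rightarrow> 'a endo \<Rightarrow> real" where
  "dist_endo S T = norm (S - T)"
definition sgn_endo :: "'a endo \<Rightarrow> 'a endo" where
  "sgn_endo S = inverse (norm S) *\<^sub>R S"
definition uniformity_endo :: "('a endo \<times> 'a endo) filter" where
  "uniformity_endo = (INF e\<in>{0<..}. principal {(x, y). dist x y < e})"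
definition open_endo :: "'a endo set \<Rightarrow> bool" where
  "open_endo U \<longleftrightarrow> (\<forall>x\<in>U. eventually (\<lambda>(x', y). x' = x \<longrightarrow> y \<in> U) uniformity)"

instance
proof
  show "(0 :: 'a endo) \<noteq> 1"
    by transfer (metis norm_blinfun_id norm_zero zero_neq_one)
  show "norm (S + T) \<le> norm S + norm T" for S T :: "'a endo"
    by transfer (rule norm_triangle_ineq)
  show "norm (S * T) \<le> norm S * norm T" for S T :: "'a endo"
    by transfer (rule norm_blinfun_compose)
  show "R * S * T = R * (S * T)" "1 * S = S" "S * 1 = S" for R S T :: "'a endo"
    by (transfer, simp add: blinfun_eqI)+
qed (transfer; simp add: algebra_simps dist_endo_def sgn_endo_def
    uniformity_endo_def open_endo_def bounded_bilinear.add_left[OF bounded_bilinear_blinfun_compose]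
    bounded_bilinear.add_right[OF bounded_bilinear_blinfun_compose]
    bounded_bilinear.scaleR_left[OF bounded_bilinear_blinfun_compose]
    bounded_bilinear.scaleR_right[OF bounded_bilinear_blinfun_compose])+

end

lemma norm_delta: "norm (delta t) = 1"
proof -
  have "(norm (delta t))\<^sup>2 = (\<Sum>\<^sub>\<infinity>x\<in>{t}. 1)"
    unfolding norm_ell2_squared by (rule infsum_cong_neutral) (auto simp: delta.rep_eq)
  then show ?thesis
    by (simp add: power2_eq_1_iff) (use norm_ge_zero[of "delta t"] in linarith)
qed

instance ell2 :: (type) perfect_space
proof
  fix f :: "'a ell2"
  show "\<not> open {f}"
  proof
    assume "open {f}"
    then obtain e where e: "e > 0" "\<And>g. dist g f < e \<Longrightarrow> g = f"
      unfolding open_dist by auto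
    have "f + (e / 2) *\<^sub>R delta undefined = f"
      using e(1) by (intro e(2)) (simp add: dist_norm norm_delta)
    then have "(e / 2) *\<^sub>R delta (undefined :: 'a) = 0" by simp
    then have "norm ((e / 2) *\<^sub>R delta (undefined :: 'a)) = 0" by simp
    then show False using e(1) by (simp add: norm_delta)
  qed
qed

section \<open>Matrix coefficients\<close>

lemma norm_ell2_apply_le: "cmod (ell2_apply f x) \<le> norm f"
proof (rule power2_le_imp_le)
  have "(cmod (ell2_apply f x))\<^sup>2 = (\<Sum>\<^sub>\<infinity>y\<in>{x}. (cmod (ell2_apply f y))\<^sup>2)" by simp
  also have "\<dots> \<le> (\<Sum>\<^sub>\<infinity>y. (cmod (ell2_apply f y))\<^sup>2)"
    by (rule infsum_mono2) (auto simp: ell2_summable)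
  finally show "(cmod (ell2_apply f x))\<^sup>2 \<le> (norm f)\<^sup>2" by (simp add: norm_ell2_squared)
qed simp

lemma bounded_linear_ell2_apply: "bounded_linear (\<lambda>f. ell2_apply f x)"
  by (rule bounded_linear_intro[where K = 1])
    (auto simp: plus_ell2.rep_eq scaleR_ell2.rep_eq scaleR_conv_of_real norm_ell2_apply_le)

lemma ell2_apply_sum: "ell2_apply (sum f F) x = (\<Sum>i\<in>F. ell2_apply (f i) x)"
  using bounded_linear_ell2_apply[of x]
  by (intro linear_sum) (auto dest: bounded_linear.linear)

lemma cinner_delta: "cinner (delta x) f = ell2_apply f x"
proof -
  have "cinner (delta x) f = (\<Sum>\<^sub>\<infinity>y\<in>{x}. ell2_apply f y)"
    unfolding cinner_def by (rule infsum_cong_neutral) (auto simp: delta.rep_eq)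
  then show ?thesis by simp
qed

text \<open>The squared distance from a partial sum to \<open>f\<close> is the tail of the series
  for the squared norm. Convergence is in norm, so bounded linear maps apply termwise.\<close>

lemma has_sum_delta: "((\<lambda>y. scaleC_ell2 (ell2_apply f y) (delta y)) has_sum f) UNIV"
proof -
  let ?c = "\<lambda>y. (cmod (ell2_apply f y))\<^sup>2"
  let ?P = "\<lambda>F. \<Sum>y\<in>F. scaleC_ell2 (ell2_apply f y) (delta y)"
  have P: "(norm (?P F - f))\<^sup>2 = infsum ?c UNIV - sum ?c F" if "finite F" for F
  proof -
    have *: "ell2_apply (?P F - f) x = (if x \<in> F then 0 else - ell2_apply f x)" for x
    proof -
      have "ell2_apply (?P F) x = (\<Sum>y\<in>F. if y = x then ell2_apply f y else 0)"
        unfolding ell2_apply_sum by (rule sum.cong) (auto simp: scaleC_ell2.rep_eq delta.rep_eq)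
      then show ?thesis using that by (simp add: minus_ell2.rep_eq sum.delta)
    qed
    have "(norm (?P F - f))\<^sup>2 = infsum ?c (UNIV - F)"
      unfolding norm_ell2_squared * by (rule infsum_cong_neutral) auto
    also have "\<dots> = infsum ?c UNIV - infsum ?c F"
      using that by (intro infsum_Diff ell2_summable summable_on_finite) auto
    finally show ?thesis using that by simp
  qed
  have "((\<lambda>F. infsum ?c UNIV - sum ?c F) \<longlongrightarrow> infsum ?c UNIV - infsum ?c UNIV) (finite_subsets_at_top UNIV)"
    by (intro tendsto_diff tendsto_const infsum_tendsto ell2_summable)
  then have "((\<lambda>F. infsum ?c UNIV - sum ?c F) \<longlongrightarrow> 0) (finite_subsets_at_top UNIV)"
    by (simp only: diff_self)
  then have "((\<lambda>F. (norm (?P F - f))\<^sup>2) \<longlongrightarrow> 0) (finite_subsets_at_top UNIV)"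
    by (rule Lim_transform_eventually) (auto intro!: eventually_finite_subsets_at_top_weakI simp: P)
  then have "((\<lambda>F. sqrt ((norm (?P F - f))\<^sup>2)) \<longlongrightarrow> sqrt 0) (finite_subsets_at_top UNIV)"
    by (rule tendsto_real_sqrt)
  then have "((\<lambda>F. norm (?P F - f)) \<longlongrightarrow> 0) (finite_subsets_at_top UNIV)" by simp
  then show ?thesis
    unfolding has_sum_def by (simp add: LIM_zero_iff[of "?P" f] tendsto_norm_zero_iff)
qed

text \<open>This is \<open>cinner (delta x) (blinfun_apply T (delta y))\<close>, one of the
  coefficients that define the weak operator topology.\<close>

definition entry :: "'a op \<Rightarrow> 'a \<Rightarrow> 'a \<Rightarrow> complex" where
  "entry T x y = ell2_apply (blinfun_apply T (delta y)) x"

lemma entry_scaleC: "entry (scaleC_op c T) x y = c * entry T x y"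
  by (simp add: entry_def scaleC_op_apply scaleC_ell2.rep_eq)

lemma entry_add: "entry (S + T) x y = entry S x y + entry T x y"
  by (simp add: entry_def blinfun.add_left plus_ell2.rep_eq)

lemma entry_compose_has_sum:
  assumes "S \<in> bounded_clinear_ops"
  shows "((\<lambda>y. entry S x y * entry T y z) has_sum entry (S o\<^sub>L T) x z) UNIV"
proof -
  have "bounded_linear (\<lambda>f. ell2_apply (blinfun_apply S f) x)"
    by (intro bounded_linear_compose[OF bounded_linear_ell2_apply] blinfun.bounded_linear_right)
  from has_sum_bounded_linear[OF this has_sum_delta[of "blinfun_apply T (delta z)"]]
  show ?thesis
    using assms by (simp add: bounded_clinear_ops_def scaleC_ell2.rep_eq entry_def mult.commute)
qed

section \<open>The trace on a twisted group von Neumann algebra\<close>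

lemma bij_add_right: "bij (\<lambda>y :: 'g::group_add. y + t)"
  by (rule bij_betw_byWitness[where f' = "\<lambda>y. y - t"]) auto

locale unit_cocycle =
  fixes \<omega> :: "'g::group_add \<Rightarrow> 'g \<Rightarrow> complex"
  assumes norm_eq_1: "cmod (\<omega> s t) = 1"
    and cocycle: "\<omega> a b * \<omega> (a + b) c = \<omega> a (b + c) * \<omega> b c"
    and zero_left: "\<omega> 0 a = 1" and zero_right: "\<omega> a 0 = 1"
begin

text \<open>
  The operators that commute with the twisted right translations
  \<open>\<delta>\<^sub>s \<mapsto> \<omega>(s,t) \<delta>\<^sub>s\<^sub>t\<close>, in terms of their matrix coefficients.
\<close>

definition commutant :: "'g op set" where
  "commutant = {T \<in> bounded_clinear_ops.
     \<forall>x s t. entry T (x + t) (s + t) * \<omega> s t = \<omega> x t * entry T x s}"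

lemma commutantD:
  assumes "T \<in> commutant"
  shows "T \<in> bounded_clinear_ops" "entry T (x + t) (s + t) * \<omega> s t = \<omega> x t * entry T x s"
  using assms by (auto simp: commutant_def)

text \<open>After the summation index of the matrix product is shifted by \<open>t\<close>, the
  relation for \<open>T\<close> releases a factor \<open>\<omega> y t\<close>, which the relation
  for \<open>S\<close> turns into \<open>\<omega> x t\<close>.\<close>

lemma compose_in_commutant:
  assumes S: "S \<in> commutant" and T: "T \<in> commutant"
  shows "S o\<^sub>L T \<in> commutant"
proof -
  have "entry (S o\<^sub>L T) (x + t) (s + t) * \<omega> s t = \<omega> x t * entry (S o\<^sub>L T) x s" for x s t
  proof -
    have "((\<lambda>y. entry S (x + t) (y + t) * entry T (y + t) (s + t)) has_sum entry (S o\<^sub>L T) (x + t) (s + t)) UNIV"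
      using entry_compose_has_sum[OF commutantD(1)[OF S], of "x + t" T "s + t"]
        has_sum_reindex_bij_betw[OF bij_add_right[of t], of "\<lambda>y. entry S (x + t) y * entry T y (s + t)"]
      by simp
    from has_sum_cmult_left[OF this, of "\<omega> s t"]
    have "((\<lambda>y. \<omega> x t * (entry S x y * entry T y s)) has_sum entry (S o\<^sub>L T) (x + t) (s + t) * \<omega> s t) UNIV"
      by (simp add: mult.assoc commutantD(2)[OF T])
         (simp add: mult.assoc[symmetric] commutantD(2)[OF S])
    moreover have "((\<lambda>y. \<omega> x t * (entry S x y * entry T y s)) has_sum \<omega> x t * entry (S o\<^sub>L T) x s) UNIV"
      by (intro has_sum_cmult_right entry_compose_has_sum commutantD(1)[OF S])
    ultimately show ?thesis by (rule has_sum_unique)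
  qed
  moreover have "S o\<^sub>L T \<in> bounded_clinear_ops"
    using commutantD(1)[OF S] commutantD(1)[OF T] by (simp add: bounded_clinear_ops_def)
  ultimately show ?thesis by (simp add: commutant_def)
qed

lemma subspace_commutant: "complex_op.subspace commutant"
proof (rule complex_op.subspaceI)
  have "entry (0 :: 'g op) x s = 0" for x s
    by (simp add: entry_def zero_ell2.rep_eq)
  moreover have "scaleC_ell2 c (0 :: 'g ell2) = 0" for c
    by (rule ell2_eqI) (simp add: scaleC_ell2.rep_eq zero_ell2.rep_eq)
  ultimately show "0 \<in> commutant"
    by (auto simp: commutant_def bounded_clinear_ops_def)
  show "S + T \<in> commutant" if "S \<in> commutant" "T \<in> commutant" for S T
    using that
    by (auto simp: commutant_def bounded_clinear_ops_def entry_add blinfun.add_left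
        scaleC_ell2_add_right distrib_left distrib_right)
  show "scaleC_op c T \<in> commutant" if "T \<in> commutant" for c T
    using that
    by (auto simp: commutant_def bounded_clinear_ops_def entry_scaleC scaleC_op_apply
        scaleC_ell2_assoc mult.commute[of c] mult.assoc mult.left_commute[of c])
qed

lemma id_in_commutant: "id_blinfun \<in> commutant"
  by (auto simp: commutant_def bounded_clinear_ops_def entry_def delta.rep_eq)

lemma entry_twisted_translation:
  "entry (twisted_translation \<omega> a) x s = (if x = a + s then \<omega> a s else 0)"
  by (simp add: entry_def twisted_translation_delta norm_eq_1 scaleC_ell2.rep_eq delta.rep_eq)

text \<open>For \<open>x = a + s\<close> the required relation is the cocycle identity at
  \<open>a\<close>, \<open>s\<close>, \<open>t\<close>; for other \<open>x\<close> both entries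
  vanish.\<close>

lemma twisted_translation_in_commutant: "twisted_translation \<omega> a \<in> commutant"
proof -
  have "x + t = a + (s + t) \<longleftrightarrow> x = a + s" for x s t
    by (metis add.assoc add_right_cancel)
  then show ?thesis
    using cocycle twisted_translation_clinear[of \<omega> a] norm_eq_1
    by (auto simp: commutant_def entry_twisted_translation mult.commute)
qed

text \<open>Each defining relation of \<open>commutant\<close> involves two matrix coefficients,
  which are weakly continuous, so \<open>commutant\<close> is a weakly closed subspace containing
  the generators.\<close>

lemma twisted_vN_algebra_subset_commutant: "twisted_vN_algebra \<omega> \<subseteq> commutant"
  unfolding twisted_vN_algebra_def
proof (rule closure_of_minimal)
  show "complex_op.span (range (twisted_translation \<omega>)) \<subseteq> commutant"
    by (intro complex_op.span_minimal subspace_commutant) (auto intro: twisted_translation_in_commutant)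
  let ?W = "weak_operator_topology :: 'g op topology"
  define \<Phi> where "\<Phi> = (\<lambda>x s t T. entry T (x + t) (s + t) * \<omega> s t - \<omega> x t * entry T x s)"
  have "closedin ?W {T \<in> topspace ?W. \<Phi> x s t T \<in> {0}}" for x s t
  proof (rule closedin_continuous_map_preimage)
    have "continuous_map euclidean euclidean (\<lambda>\<phi> :: 'g ell2 \<times> 'g ell2 \<Rightarrow> complex.
        \<phi> (delta (x + t), delta (s + t)) * \<omega> s t - \<omega> x t * \<phi> (delta x, delta s))"
      unfolding continuous_map_iff_continuous2 by (intro continuous_intros) auto
    from continuous_map_pullback[OF this, of bounded_clinear_ops "\<lambda>T (f, g). cinner f (blinfun_apply T g)"]
    show "continuous_map ?W euclidean (\<Phi> x s t)"
      unfolding weak_operator_topology_def \<Phi>_def comp_def by (simp add: cinner_delta entry_def)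
  qed simp
  then have "closedin ?W (\<Inter>(x, s, t)\<in>UNIV. {T \<in> topspace ?W. \<Phi> x s t T \<in> {0}})"
    by (intro closedin_Inter) auto
  also have "(\<Inter>(x, s, t)\<in>UNIV. {T \<in> topspace ?W. \<Phi> x s t T \<in> {0}}) = commutant"
    by (auto simp: commutant_def \<Phi>_def weak_operator_topology_def topspace_pullback_topology)
  finally show "closedin ?W commutant" .
qed

text \<open>The commutant relation expresses row 0 of a matrix through column 0. Both sides then
  become the same sum under \<open>y \<mapsto> - y\<close>, because
  \<open>\<omega> x (- x) = \<omega> (- x) x\<close>.\<close>

lemma entry_zero_commute:
  assumes S: "S \<in> commutant" and T: "T \<in> commutant"
  shows "entry (S o\<^sub>L T) 0 0 = entry (T o\<^sub>L S) 0 0"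
proof -
  have row: "entry R 0 (- x) = \<omega> x (- x) * entry R x 0" if "R \<in> commutant" for R x
    using commutantD(2)[OF that, of x "- x" 0] by (simp add: zero_left)
  have sym: "\<omega> x (- x) = \<omega> (- x) x" for x
    using cocycle[of x "- x" x] by (simp add: zero_left zero_right)
  have "bij (uminus :: 'g \<Rightarrow> 'g)"
    by (rule bij_betw_byWitness[where f' = uminus]) auto
  from entry_compose_has_sum[OF commutantD(1)[OF T], of 0 S 0]
  have "((\<lambda>y. entry T 0 (- y) * entry S (- y) 0) has_sum entry (T o\<^sub>L S) 0 0) UNIV"
    using has_sum_reindex_bij_betw[OF \<open>bij uminus\<close>, of "\<lambda>y. entry T 0 y * entry S y 0"] by simp
  moreover have "entry T 0 (- y) * entry S (- y) 0 = entry S 0 y * entry T y 0" for y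
    using row[OF T, of y] row[OF S, of "- y"] sym[of y] by simp
  ultimately have "((\<lambda>y. entry S 0 y * entry T y 0) has_sum entry (T o\<^sub>L S) 0 0) UNIV"
    by simp
  then show ?thesis
    using entry_compose_has_sum[OF commutantD(1)[OF S], of 0 T 0] has_sum_unique by blast
qed

end

definition canonical_trace :: "'g::group_add ell2 endo \<Rightarrow> complex" where
  "canonical_trace S = entry (endo_blinfun S) 0 0"

lemma bounded_linear_canonical_trace: "bounded_linear canonical_trace"
proof (rule bounded_linear_intro[where K = 1])
  show "canonical_trace (S + T) = canonical_trace S + canonical_trace T" for S T
    by (simp add: canonical_trace_def plus_endo.rep_eq entry_add)
  show "canonical_trace (r *\<^sub>R S) = r *\<^sub>R canonical_trace S" for r S
    by (simp add: canonical_trace_def scaleR_endo.rep_eq entry_def blinfun.scaleR_left scaleR_ell2.rep_eq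
        scaleR_conv_of_real[of _ "_ :: complex"])
  show "norm (canonical_trace S) \<le> norm S * 1" for S
    using norm_ell2_apply_le[of "blinfun_apply (endo_blinfun S) (delta 0)" 0]
      norm_blinfun[of "endo_blinfun S" "delta 0"]
    by (simp add: canonical_trace_def entry_def norm_endo.rep_eq norm_delta)
qed

text \<open>The algebra \<open>endo\<close> is a real one, so complex multiples of the identity
  enter as elements of it.\<close>

definition scalar :: "complex \<Rightarrow> 'a ell2 endo" where
  "scalar c = Endo (scaleC_op c id_blinfun)"

lemma endo_eqI: "(\<And>f. blinfun_apply (endo_blinfun S) f = blinfun_apply (endo_blinfun T) f) \<Longrightarrow> S = T"
  by (metis blinfun_eqI endo_blinfun_inject)

lemma scalar_apply: "blinfun_apply (endo_blinfun (scalar c)) f = scaleC_ell2 c f"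
  by (simp add: scalar_def Endo_inverse scaleC_op_apply)

lemma scalar_mult: "scalar (c * d) = scalar c * scalar d"
  by (rule endo_eqI) (simp add: times_endo.rep_eq scalar_apply scaleC_ell2_assoc)

lemma scalar_one: "scalar 1 = 1"
  by (rule endo_eqI) (simp add: one_endo.rep_eq scalar_apply scaleC_ell2_one)

lemma scalar_diff: "scalar (c - d) = scalar c - scalar d"
  by (rule endo_eqI, rule ell2_eqI)
    (simp add: minus_endo.rep_eq scalar_apply blinfun.diff_left minus_ell2.rep_eq scaleC_ell2.rep_eq algebra_simps)

lemma one_minus_scalar: "1 - scalar c = scalar (1 - c)"
  by (simp add: scalar_diff scalar_one)

lemma scalar_power: "scalar (c ^ n) = scalar c ^ n"
  by (induction n) (simp_all add: scalar_one scalar_mult)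

lemma norm_scalar_le: "norm (scalar c) \<le> cmod c"
  unfolding norm_endo.rep_eq
  by (rule norm_blinfun_bound) (simp_all add: scalar_apply norm_scaleC_ell2)

lemma canonical_trace_scalar: "canonical_trace (scalar c) = c"
  by (simp add: canonical_trace_def entry_def scalar_apply scaleC_ell2.rep_eq delta.rep_eq)

context unit_cocycle
begin

abbreviation "commutant_algebra \<equiv> {S. endo_blinfun S \<in> commutant}"

sublocale traced_algebra commutant_algebra canonical_trace
proof (rule traced_algebra.intro)
  have scaleR: "r *\<^sub>R T = scaleC_op (of_real r) T" for r and T :: "'g op"
    by (rule blinfun_eqI) (simp add: scaleC_op_apply blinfun.scaleR_left scaleR_conv_scaleC_ell2)
  show "1 \<in> commutant_algebra" by (simp add: one_endo.rep_eq id_in_commutant)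
  show "S - T \<in> commutant_algebra" if "S \<in> commutant_algebra" "T \<in> commutant_algebra" for S T
    using that by (simp add: minus_endo.rep_eq complex_op.subspace_diff subspace_commutant)
  show "S * T \<in> commutant_algebra" if "S \<in> commutant_algebra" "T \<in> commutant_algebra" for S T
    using that by (simp add: times_endo.rep_eq compose_in_commutant)
  show "r *\<^sub>R S \<in> commutant_algebra" if "S \<in> commutant_algebra" for r S
    using that by (simp add: scaleR_endo.rep_eq scaleR complex_op.subspace_scale subspace_commutant)
  show "canonical_trace (S * T) = canonical_trace (T * S)" if "S \<in> commutant_algebra" "T \<in> commutant_algebra" for S T
    using that by (simp add: canonical_trace_def times_endo.rep_eq entry_zero_commute)
qed (rule bounded_linear_canonical_trace)

lemma scalar_in_commutant_algebra: "scalar c \<in> commutant_algebra"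
  by (simp add: scalar_def Endo_inverse complex_op.subspace_scale subspace_commutant id_in_commutant)

lemma scalar_commute: "S \<in> commutant_algebra \<Longrightarrow> S * scalar c = scalar c * S"
  by (rule endo_eqI)
    (auto simp: times_endo.rep_eq scalar_apply bounded_clinear_ops_def dest!: commutantD(1))

lemma trace_log_scalar:
  assumes "cmod (1 - c) < 1"
  shows "trace_log (1 - scalar c) = - Ln c"
proof -
  have "(\<lambda>k. - ((- (c - 1)) ^ k) / of_nat k) sums ln (1 + (c - 1))"
    using assms by (intro Ln_series') (simp add: norm_minus_commute)
  then have "(\<lambda>k. - (- ((- (c - 1)) ^ k) / of_nat k)) sums - Ln c"
    by (intro sums_minus) simp
  then have "(\<lambda>k. (1 - c) ^ Suc k / of_nat (Suc k)) sums - Ln c"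
    \<comment> \<open>The term at \<open>k = 0\<close> is a division by zero, hence 0, so the index
      shift leaves the sum unchanged.\<close>
    by (subst sums_Suc_iff) simp
  then show ?thesis
    unfolding trace_log_def one_minus_scalar by (simp only: scalar_power[symmetric] canonical_trace_scalar sums_iff)
qed

section \<open>Perturbing a projective representation to a representation\<close>

definition proj_rep :: "'g \<Rightarrow> 'g ell2 endo" where
  "proj_rep s = Endo (twisted_translation \<omega> s)"

lemma proj_rep_in_commutant_algebra: "proj_rep s \<in> commutant_algebra"
  by (simp add: proj_rep_def Endo_inverse twisted_translation_in_commutant)

lemma norm_proj_rep_le: "norm (proj_rep s) \<le> 1"
  unfolding norm_endo.rep_eq proj_rep_def Endo_inverse[OF UNIV_I]
  by (rule norm_blinfun_bound) (simp_all add: norm_twisted_translation_apply norm_eq_1)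

lemma proj_rep_mult: "proj_rep a * proj_rep b = scalar (\<omega> a b) * proj_rep (a + b)"
proof (rule endo_eqI, rule ell2_eqI)
  fix f x
  have "- b + (- a + x) = - (a + b) + x"
    by (metis minus_add add.assoc)
  moreover have "\<omega> a (- a + x) * \<omega> b (- (a + b) + x) = \<omega> a b * \<omega> (a + b) (- (a + b) + x)"
  proof -
    have "b + (- (a + b) + x) = - a + x"
    proof -
      have "b + (- (a + b) + x) = (b + - b) + (- a + x)"
        by (simp only: minus_add add.assoc)
      then show ?thesis by simp
    qed
    then show ?thesis
      using cocycle[of a b "- (a + b) + x"] by (simp only:)
  qed
  ultimately show "ell2_apply (blinfun_apply (endo_blinfun (proj_rep a * proj_rep b)) f) x =
      ell2_apply (blinfun_apply (endo_blinfun (scalar (\<omega> a b) * proj_rep (a + b))) f) x"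
    by (simp add: times_endo.rep_eq proj_rep_def Endo_inverse scalar_apply scaleC_ell2.rep_eq
        twisted_translation_apply norm_eq_1 mult.assoc[symmetric])
qed

text \<open>
  Writing \<open>\<rho>(s) = \<pi>(s) (1 - u(s))\<close>, the projective relation for \<open>\<rho>\<close> becomes
  \<open>(\<pi>(b)\<^sup>-\<^sup>1 (1 - u(a)) \<pi>(b)) (1 - u(b)) = \<omega>(a,b) (1 - u(a + b))\<close>, in which the conjugation is
  invisible to the trace of the logarithm.
\<close>

lemma Ln_eq_trace_log_perturbation:
  fixes P :: "'g \<Rightarrow> 'g ell2 endo"
  defines "u \<equiv> \<lambda>s. 1 - P (- s) * proj_rep s"
  assumes hom: "\<And>s t. P (s + t) = P s * P t" and zero: "P 0 = 1"
    and alg: "\<And>s. P s \<in> commutant_algebra"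
    and close: "\<And>s. s \<in> {a, - a, b, - b, a + b, - (a + b)} \<Longrightarrow> norm (proj_rep s - P s) \<le> 1/32"
    and \<omega>: "cmod (1 - \<omega> a b) \<le> 1/4"
  shows "Ln (\<omega> a b) = trace_log (u (a + b)) - trace_log (u a) - trace_log (u b)"
proof -
  have inv: "P s * P (- s) = 1" "P (- s) * P s = 1" for s
    using hom[of s "- s"] hom[of "- s" s] zero by simp_all
  have uA: "u s \<in> commutant_algebra" for s
    unfolding u_def by (intro closed alg proj_rep_in_commutant_algebra)
  \<comment> \<open>\<open>33/32\<close> is \<open>1 + 1/32\<close>. The tolerance
    \<open>1/32\<close> keeps \<open>u\<close> and its conjugate \<open>w\<close> below the bound
    \<open>1/4\<close> required by \<open>trace_log_mult\<close>.\<close>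
  have nP: "norm (P s) \<le> 33/32" if "norm (proj_rep s - P s) \<le> 1/32" for s
    using that norm_triangle_ineq4[of "proj_rep s" "proj_rep s - P s"] norm_proj_rep_le[of s] by simp
  have nu: "norm (u s) \<le> 1/16"
    if "norm (proj_rep s - P s) \<le> 1/32" "norm (proj_rep (- s) - P (- s)) \<le> 1/32" for s
  proof -
    have "u s = P (- s) * (P s - proj_rep s)"
      by (simp add: u_def right_diff_distrib inv)
    then have "norm (u s) \<le> norm (P (- s)) * norm (P s - proj_rep s)"
      by (simp add: norm_mult_ineq)
    also have "\<dots> \<le> 33/32 * (1/32)"
      using nP[OF that(2)] that(1) by (intro mult_mono) (auto simp: norm_minus_commute)
    finally show ?thesis by simp
  qed
  have u16: "norm (u a) \<le> 1/16" "norm (u b) \<le> 1/16" "norm (u (a + b)) \<le> 1/16"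
    by (rule nu; rule close; simp)+
  define w where "w = P (- b) * u a * P b"
  have w4: "norm w \<le> 1/4"
  proof -
    have "norm w \<le> norm (P (- b)) * norm (u a) * norm (P b)"
      unfolding w_def by (meson mult_right_mono norm_ge_zero norm_mult_ineq order_trans)
    also have "\<dots> \<le> 33/32 * (1/16) * (33/32)"
      using u16 by (intro mult_mono nP close) auto
    finally show ?thesis by simp
  qed
  have wA: "w \<in> commutant_algebra"
    unfolding w_def by (intro closed alg uA)
  \<comment> \<open>The conjugation in \<open>w\<close> is designed to leave
    \<open>P b * P (- b) = 1\<close> between the two projective factors, so that these become
    adjacent.\<close>
  have "(1 - w) * (1 - u b) = P (- b) * P (- a) * proj_rep a * (P b * P (- b)) * proj_rep b"
  proof -
    have "1 - w = P (- b) * P (- a) * proj_rep a * P b"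
      by (simp add: w_def u_def left_diff_distrib right_diff_distrib mult.assoc inv)
    then show ?thesis by (simp add: u_def mult.assoc)
  qed
  also have "\<dots> = P (- (a + b)) * (proj_rep a * proj_rep b)"
    using hom[of "- b" "- a"] by (simp add: inv mult.assoc minus_add)
  also have "\<dots> = scalar (\<omega> a b) * (P (- (a + b)) * proj_rep (a + b))"
    unfolding proj_rep_mult mult.assoc[symmetric] scalar_commute[OF alg] ..
  finally have "(1 - w) * (1 - u b) = (1 - (1 - scalar (\<omega> a b))) * (1 - u (a + b))"
    by (simp add: u_def)
  then have "trace_log w + trace_log (u b) = trace_log (1 - scalar (\<omega> a b)) + trace_log (u (a + b))"
  proof (subst (1 2) trace_log_mult[symmetric])
    show "norm (1 - scalar (\<omega> a b)) \<le> 1/4"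
      unfolding one_minus_scalar by (rule order_trans[OF norm_scalar_le \<omega>])
    show "1 - scalar (\<omega> a b) \<in> commutant_algebra"
      by (intro closed scalar_in_commutant_algebra)
  qed (use u16 w4 wA uA in auto)
  moreover have "trace_log w = trace_log (u a)"
    unfolding w_def by (intro trace_log_conjugate alg uA inv)
  moreover have "trace_log (1 - scalar (\<omega> a b)) = - Ln (\<omega> a b)"
    using \<omega> by (intro trace_log_scalar) simp
  ultimately show ?thesis by (simp add: algebra_simps)
qed

end

section \<open>From a sequence of approximating homomorphisms to a contradiction\<close>

lemma homs_into_GLD:
  assumes "\<pi> \<in> homs_into_GL B"
  shows "\<pi> s \<in> B" "\<pi> (s + t) = \<pi> s o\<^sub>L \<pi> t" "\<pi> 0 = id_blinfun"
proof -
  show "\<pi> s \<in> B" and hom: "\<pi> (s + t) = \<pi> s o\<^sub>L \<pi> t" for s t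
    using assms by (auto simp: homs_into_GL_def GL_def)
  \<comment> \<open>\<open>\<pi> 0\<close> is idempotent, and cancelling it with a left inverse
    leaves the identity.\<close>
  obtain S where "S o\<^sub>L \<pi> 0 = id_blinfun"
    using assms unfolding homs_into_GL_def GL_def by blast
  moreover have "S o\<^sub>L \<pi> 0 = (S o\<^sub>L \<pi> 0) o\<^sub>L \<pi> 0"
    using hom[of 0 0] by (metis add_0 blinfun_apply_blinfun_compose blinfun_eqI)
  ultimately show "\<pi> 0 = id_blinfun"
    by (metis blinfun_apply_blinfun_compose blinfun_eqI blinfun_apply_id_blinfun)
qed

lemma unit_cocycle_exp_cocycle:
  assumes "\<sigma> \<in> two_cocycles" "normalized \<sigma>"
  shows "unit_cocycle (exp_cocycle \<sigma> n)"
proof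
  show "exp_cocycle \<sigma> n a b * exp_cocycle \<sigma> n (a + b) c = exp_cocycle \<sigma> n a (b + c) * exp_cocycle \<sigma> n b c" for a b c
  proof -
    have "\<sigma> a b + \<sigma> (a + b) c = \<sigma> a (b + c) + \<sigma> b c"
      using assms(1) by (simp add: two_cocycles_def)
    then have "complex_of_real (\<sigma> a b) + of_real (\<sigma> (a + b) c) = of_real (\<sigma> a (b + c)) + of_real (\<sigma> b c)"
      by (metis of_real_add)
    then show ?thesis
      unfolding exp_cocycle_def exp_add[symmetric] add_divide_distrib[symmetric] distrib_left[symmetric]
      by simp
  qed
qed (use assms(2) in \<open>auto simp: norm_exp_cocycle normalized_def exp_cocycle_def\<close>)

lemma exp_cocycle_tendsto: "(\<lambda>n. exp_cocycle \<sigma> n a b) \<longlonglongrightarrow> 1"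
proof -
  have "(\<lambda>n. exp (2 * of_real pi * \<i> * of_real (\<sigma> a b) / of_nat n)) \<longlonglongrightarrow> exp 0"
    by (intro tendsto_exp lim_const_over_n)
  then show ?thesis by (simp add: exp_cocycle_def)
qed

text \<open>The bound puts the angle strictly between \<open>- pi\<close> and \<open>pi\<close>, so
  the principal logarithm recovers it without a multiple of \<open>2 * pi\<close>.\<close>

lemma Im_Ln_exp_cocycle:
  assumes "2 * \<bar>\<sigma> a b\<bar> < n"
  shows "Im (Ln (exp_cocycle \<sigma> n a b)) = 2 * pi * \<sigma> a b / n"
proof -
  have n: "real n > 0" using assms by linarith
  have z: "2 * of_real pi * \<i> * of_real (\<sigma> a b) / of_nat n = \<i> * of_real (2 * pi * \<sigma> a b / n)"
    by simp
  have "\<bar>2 * pi * \<sigma> a b / n\<bar> < pi"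
    using assms n by (simp add: abs_mult field_simps)
  then have "- pi < 2 * pi * \<sigma> a b / n" "2 * pi * \<sigma> a b / n \<le> pi"
    by linarith+
  then show ?thesis
    unfolding exp_cocycle_def z by (subst Ln_exp) simp_all
qed

theorem theorem1p1:
  fixes \<sigma> :: "'g::{group_add, countable} \<Rightarrow> 'g \<Rightarrow> real"
  assumes "\<sigma> \<in> two_cocycles"
    and "normalized \<sigma>"
    and "H2_class \<sigma> \<noteq> H2_zero"
  shows "\<not> (\<exists>\<pi> :: nat \<Rightarrow> 'g \<Rightarrow> 'g op.
    (\<forall>n\<ge>1. \<pi> n \<in> homs_into_GL (twisted_vN_algebra (exp_cocycle \<sigma> n))) \<and>
    (\<forall>s. (\<lambda>n. norm (twisted_translation (exp_cocycle \<sigma> n) s - \<pi> n s)) \<longlonglongrightarrow> 0))"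
proof
  assume "\<exists>\<pi> :: nat \<Rightarrow> 'g \<Rightarrow> 'g op.
    (\<forall>n\<ge>1. \<pi> n \<in> homs_into_GL (twisted_vN_algebra (exp_cocycle \<sigma> n))) \<and>
    (\<forall>s. (\<lambda>n. norm (twisted_translation (exp_cocycle \<sigma> n) s - \<pi> n s)) \<longlonglongrightarrow> 0)"
  then obtain \<pi> :: "nat \<Rightarrow> 'g \<Rightarrow> 'g op"
    where hom: "\<And>n. n \<ge> 1 \<Longrightarrow> \<pi> n \<in> homs_into_GL (twisted_vN_algebra (exp_cocycle \<sigma> n))"
      and lim: "\<And>s. (\<lambda>n. norm (twisted_translation (exp_cocycle \<sigma> n) s - \<pi> n s)) \<longlonglongrightarrow> 0"
    by blast
  let ?\<omega> = "exp_cocycle \<sigma>"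
  \<comment> \<open>The factor \<open>n / (2 * pi)\<close> undoes the scaling of the exponent in
    \<open>exp_cocycle\<close>, and the minus sign compensates for the one in
    \<open>trace_log\<close>.\<close>
  define \<gamma> where "\<gamma> = (\<lambda>n s. - (real n / (2 * pi) * Im (traced_algebra.trace_log canonical_trace
      (1 - Endo (\<pi> n (- s)) * unit_cocycle.proj_rep (?\<omega> n) s))))"
  have "\<forall>\<^sub>F n in sequentially. \<sigma> a b = \<gamma> n a - \<gamma> n (a + b) + \<gamma> n b" for a b
  proof -
    let ?S = "{a, - a, b, - b, a + b, - (a + b)}"
    \<comment> \<open>The thresholds \<open>1/32\<close> and \<open>1/4\<close> are those of
      \<open>Ln_eq_trace_log_perturbation\<close>; how large \<open>n\<close> must be depends on
      \<open>a\<close> and \<open>b\<close>.\<close>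
    have "\<forall>\<^sub>F n in sequentially. \<forall>s\<in>?S. norm (twisted_translation (?\<omega> n) s - \<pi> n s) < 1/32"
      by (intro eventually_ball_finite ballI order_tendstoD(2)[OF lim]) auto
    moreover have "\<forall>\<^sub>F n in sequentially. dist (?\<omega> n a b) 1 < 1/4"
      by (rule tendstoD[OF exp_cocycle_tendsto]) simp
    moreover have "\<forall>\<^sub>F n in sequentially. 2 * \<bar>\<sigma> a b\<bar> < real n"
      using filterlim_real_sequentially by (simp add: filterlim_at_top_dense)
    ultimately show ?thesis
    proof eventually_elim
      case (elim n)
      interpret unit_cocycle "?\<omega> n"
        by (rule unit_cocycle_exp_cocycle[OF assms(1,2)])
      have n: "n > 0" using elim(3) by (cases n) auto
      note \<pi> = homs_into_GLD[OF hom[of n]]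
      have "Ln (?\<omega> n a b) = trace_log (1 - Endo (\<pi> n (- (a + b))) * proj_rep (a + b))
          - trace_log (1 - Endo (\<pi> n (- a)) * proj_rep a) - trace_log (1 - Endo (\<pi> n (- b)) * proj_rep b)"
      proof (rule Ln_eq_trace_log_perturbation)
        show "Endo (\<pi> n (s + t)) = Endo (\<pi> n s) * Endo (\<pi> n t)" for s t
          using \<pi>(2)[of s t] n by (simp add: times_endo.abs_eq)
        show "Endo (\<pi> n 0) = 1"
          using \<pi>(3) n by (simp add: one_endo_def)
        show "Endo (\<pi> n s) \<in> commutant_algebra" for s
          using \<pi>(1)[of s] n twisted_vN_algebra_subset_commutant by (auto simp: Endo_inverse)
        show "norm (proj_rep s - Endo (\<pi> n s)) \<le> 1/32" if "s \<in> ?S" for s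
          using elim(1) that by (force simp: proj_rep_def norm_endo.rep_eq minus_endo.rep_eq Endo_inverse)
        show "cmod (1 - ?\<omega> n a b) \<le> 1/4"
          using elim(2) by (simp add: dist_norm norm_minus_commute)
      qed
      from arg_cong[OF this, of "\<lambda>z. real n / (2 * pi) * Im z"]
      have "real n / (2 * pi) * (2 * pi * \<sigma> a b / n) = - \<gamma> n (a + b) + \<gamma> n a + \<gamma> n b"
        unfolding Im_Ln_exp_cocycle[of \<sigma> a b n, OF elim(3)] \<gamma>_def
        by (simp only: minus_complex.sel right_diff_distrib)
      moreover have "real n / (2 * pi) * (2 * pi * \<sigma> a b / n) = \<sigma> a b"
        using n by simp
      ultimately show ?case by linarith
    qed
  qed
  then have "\<exists>\<gamma>. \<forall>(a, b)\<in>F. \<sigma> a b = \<gamma> a - \<gamma> (a + b) + \<gamma> b" if "finite F" for F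
  proof -
    assume *: "\<And>a b. \<forall>\<^sub>F n in sequentially. \<sigma> a b = \<gamma> n a - \<gamma> n (a + b) + \<gamma> n b"
    \<comment> \<open>Finitely many eventual equations hold together at some \<open>n\<close>, and
      \<open>\<gamma> n\<close> for that \<open>n\<close> solves the system on \<open>F\<close>; no
      limit of the \<open>\<gamma> n\<close> is taken.\<close>
    have "\<forall>\<^sub>F n in sequentially. \<forall>(a, b)\<in>F. \<sigma> a b = \<gamma> n a - \<gamma> n (a + b) + \<gamma> n b"
      using that * by (intro eventually_ball_finite) auto
    then have "\<exists>n. \<forall>(a, b)\<in>F. \<sigma> a b = \<gamma> n a - \<gamma> n (a + b) + \<gamma> n b"
      using eventually_happens sequentially_bot by blast
    then show ?thesis by blast
  qed
  then have "\<sigma> \<in> two_coboundaries"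
    by (rule two_coboundary_if_finitely)
  then show False
    using assms(3) H2_class_eq_zero_iff[OF assms(1)] by simp
qed

end
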